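(* Let $G=\langle S\mid R\rangle$ be a group with a symmetric triangular presentation and fix $\varepsilon\ge0$. Let $\rho:S\to\mathrm{GL}(W)$ be a function, where $W$ is a finite-dimensional vector space over a field $\mathbb F$. Suppose that (a) $d_{\mathrm{rk}}(\rho(s),\rho(s'))\ge1-\varepsilon/18$ for all distinct $s,s'\in S$; (b) if $s,s',s''\in S$ (not necessarily distinct) satisfy $s''s's\neq e$ in $G$, then $d_{\mathrm{rk}}(\rho(s'')\rho(s')\rho(s),\mathrm{id}_W)\ge1-\varepsilon/18$; (c) if $s,s',s''\in S$ satisfy $s''s's=e$ in $G$, then $d_{\mathrm{rk}}(\rho(s'')\rho(s')\rho(s),\mathrm{id}_W)\le\varepsilon/18$, and moreover $d_{\mathrm{rk}}(\rho(e),\mathrm{id}_W)\le\varepsilon/18$; (d) for all $s,s',s''\in S$, if $s''s's=e$ holds in $G$ then $s''s's$ is a relator in $R$. Then the generalized Dowling geometry of $\langle S\mid R\rangle$ has an $\varepsilon$-approximate vector space representation over $\mathbb F$.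
   Context: For $f,g\in\mathrm{End}(W)$, $d_{\mathrm{rk}}(f,g)=\frac{1}{\dim W}\mathrm{rk}(f-g)$. A presentation $\langle S\mid R\rangle$ is symmetric triangular if: $S,R$ finite, $e\in S$; for $e\neq s\in S$ a formal inverse $s^{-1}\in S$ with $ss^{-1}e\in R$; all relators are length-three words in $S$; if $abc\in R$ then $bca,cab,c^{-1}b^{-1}a^{-1}\in R$; $eee\in R$. Its generalized Dowling geometry is the simple rank-3 matroid on $E=\{b_1,b_2,b_3\}\cup\{s_i:s\in S,1\le i\le3\}$ in which a 3-element subset is dependent iff it lies in one of $\{b_1,b_2\}\cup\{s_1\}_{s\in S}$, $\{b_2,b_3\}\cup\{s_2\}_{s\in S}$, $\{b_3,b_1\}\cup\{s_3\}_{s\in S}$, or $\{s_i,s'_j,s''_k\}$ for a relator $s''s's\in R$ and a cyclic shift $(i,j,k)$ of $(1,2,3)$; sets of size $\le2$ are independent. For linear maps $T_e:V\to W_e$ and $A\subseteq E$, $T_A:V\to\bigoplus_{e\in A}W_e$, $v\mapsto(T_e(v))_{e\in A}$. An $\varepsilon$-approximate vector space representation of a matroid on $E$ consists of $c\in\mathbb N$, a finite-dimensional vector space $V$, spaces $W_e$ of dimension $c$ and surjective linear maps $T_e:V\to W_e$ such that (1) for every independent $A\subseteq E$, $\mathrm{rk}(T_A)\ge c(|A|-\varepsilon)$; (2) for every circuit $C$ and $x\in C$ there is a linear map $S:\bigoplus_{e\in C\setminus\{x\}}W_e\to W_x$ with $\mathrm{rk}(T_x-S\circ T_{C\setminus\{x\}})\le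 c\varepsilon$. *)

theory Defs
  imports Complex_Main "HOL-Library.Function_Algebras" "HOL-Algebra.Group"
begin

definition fin_dim_space :: "('f::field \<Rightarrow> 'v::ab_group_add \<Rightarrow> 'v) \<Rightarrow> 'v set \<Rightarrow> bool" where
  "fin_dim_space scale V \<longleftrightarrow>
     vector_space scale \<and> module.subspace scale V \<and> (\<exists>B. finite B \<and> module.span scale B = V)"

definition linear_map_on ::
  "('f::field \<Rightarrow> 'v::ab_group_add \<Rightarrow> 'v) \<Rightarrow> ('f \<Rightarrow> 'w::ab_group_add \<Rightarrow> 'w) \<Rightarrow>
   'v set \<Rightarrow> 'w set \<Rightarrow> ('v \<Rightarrow> 'w) \<Rightarrow> bool" where
  "linear_map_on sV sW V W f \<longleftrightarrow>
     f ` V \<subseteq> W \<and>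
     (\<forall>x\<in>V. \<forall>y\<in>V. f (x + y) = f x + f y) \<and>
     (\<forall>r. \<forall>x\<in>V. f (sV r x) = sW r (f x))"

definition rk :: "('f::field \<Rightarrow> 'w::ab_group_add \<Rightarrow> 'w) \<Rightarrow> 'v set \<Rightarrow> ('v \<Rightarrow> 'w) \<Rightarrow> nat" where
  "rk sW V f = vector_space.dim sW (f ` V)"

definition general_linear :: "('f::field \<Rightarrow> 'w::ab_group_add \<Rightarrow> 'w) \<Rightarrow> ('w \<Rightarrow> 'w) set" where
  "general_linear scale = {f. Vector_Spaces.linear scale scale f \<and> bij f}"

definition d_rk :: "('f::field \<Rightarrow> 'w::ab_group_add \<Rightarrow> 'w) \<Rightarrow> ('w \<Rightarrow> 'w) \<Rightarrow> ('w \<Rightarrow> 'w) \<Rightarrow> real" where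
  "d_rk scale f g =
     real (rk scale UNIV (\<lambda>x. f x - g x)) / real (vector_space.dim scale UNIV)"

definition fun_scale :: "('f \<Rightarrow> 'w \<Rightarrow> 'w) \<Rightarrow> 'f \<Rightarrow> ('i \<Rightarrow> 'w) \<Rightarrow> 'i \<Rightarrow> 'w" where
  "fun_scale scale r u = (\<lambda>i. scale r (u i))"

text \<open>The direct sum of the \<open>W i\<close> over \<open>i \<in> A\<close> (used for finite \<open>A\<close> only): families vanishing
  outside \<open>A\<close>, with pointwise operations.\<close>

definition direct_sum :: "'i set \<Rightarrow> ('i \<Rightarrow> 'w::zero set) \<Rightarrow> ('i \<Rightarrow> 'w) set" where
  "direct_sum A W = {u. (\<forall>i\<in>A. u i \<in> W i) \<and> (\<forall>i. i \<notin> A \<longrightarrow> u i = 0)}"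

definition joint_map :: "('i \<Rightarrow> 'v \<Rightarrow> 'w::zero) \<Rightarrow> 'i set \<Rightarrow> 'v \<Rightarrow> 'i \<Rightarrow> 'w" where
  "joint_map T A v = (\<lambda>i. if i \<in> A then T i v else 0)"


text \<open>A matroid is given by its ground set and its independence predicate.\<close>

definition circuit :: "'e set \<Rightarrow> ('e set \<Rightarrow> bool) \<Rightarrow> 'e set \<Rightarrow> bool" where
  "circuit E indep C \<longleftrightarrow> C \<subseteq> E \<and> \<not> indep C \<and> (\<forall>D. D \<subset> C \<longrightarrow> indep D)"

text \<open>The condition \<open>c > 0\<close> is essential: for \<open>c = 0\<close> all requirements hold vacuously.\<close>

definition approx_representation ::
  "('f::field \<Rightarrow> 'v::ab_group_add \<Rightarrow> 'v) \<Rightarrow> ('f \<Rightarrow> 'w::ab_group_add \<Rightarrow> 'w) \<Rightarrow>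
   'e set \<Rightarrow> ('e set \<Rightarrow> bool) \<Rightarrow> real \<Rightarrow>
   nat \<Rightarrow> 'v set \<Rightarrow> ('e \<Rightarrow> 'w set) \<Rightarrow> ('e \<Rightarrow> 'v \<Rightarrow> 'w) \<Rightarrow> bool" where
  "approx_representation sV sW E indep \<epsilon> c V W T \<longleftrightarrow>
     c > 0 \<and>
     fin_dim_space sV V \<and>
     (\<forall>x\<in>E. fin_dim_space sW (W x) \<and> vector_space.dim sW (W x) = c) \<and>
     (\<forall>x\<in>E. linear_map_on sV sW V (W x) (T x) \<and> T x ` V = W x) \<and>
     (\<forall>A. A \<subseteq> E \<and> indep A \<longrightarrow>
        real (rk (fun_scale sW) V (joint_map T A)) \<ge> real c * (real (card A) - \<epsilon>)) \<and>
     (\<forall>C x. circuit E indep C \<and> x \<in> C \<longrightarrow>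
        (\<exists>L. linear_map_on (fun_scale sW) sW (direct_sum (C - {x}) W) (W x) L \<and>
             real (rk sW V (\<lambda>v. T x v - L (joint_map T (C - {x}) v))) \<le> real c * \<epsilon>))"

text \<open>Types cannot be quantified existentially, so the spaces \<open>V\<close> and \<open>W x\<close> range over the
  finite-dimensional subspaces of the space of sequences over the field; up to isomorphism these
  are all finite-dimensional vector spaces.\<close>

definition has_approx_representation ::
  "'f::field itself \<Rightarrow> 'e set \<Rightarrow> ('e set \<Rightarrow> bool) \<Rightarrow> real \<Rightarrow> bool" where
  "has_approx_representation _ E indep \<epsilon> \<longleftrightarrow>
     (\<exists>c (V :: (nat \<Rightarrow> 'f) set) (W :: 'e \<Rightarrow> (nat \<Rightarrow> 'f) set) T.
        approx_representation (fun_scale (*)) (fun_scale (*)) E indep \<epsilon> c V W T)"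


text \<open>The letter \<open>(s, True)\<close> is the generator \<open>s\<close> and \<open>(s, False)\<close> is its inverse.\<close>

abbreviation group_words :: "'s set \<Rightarrow> ('s \<times> bool) list set" where
  "group_words S \<equiv> {w. fst ` set w \<subseteq> S}"

definition positive_word :: "'s list \<Rightarrow> ('s \<times> bool) list" where
  "positive_word w = map (\<lambda>s. (s, True)) w"

inductive word_equiv ::
  "'s set \<Rightarrow> ('s \<times> bool) list set \<Rightarrow> ('s \<times> bool) list \<Rightarrow> ('s \<times> bool) list \<Rightarrow> bool"
  for S R where
  refl: "u \<in> group_words S \<Longrightarrow> word_equiv S R u u"
| sym: "word_equiv S R u v \<Longrightarrow> word_equiv S R v u"
| trans: "word_equiv S R u v \<Longrightarrow> word_equiv S R v w \<Longrightarrow> word_equiv S R u w"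
| cancel: "u \<in> group_words S \<Longrightarrow> v \<in> group_words S \<Longrightarrow> s \<in> S \<Longrightarrow>
    word_equiv S R (u @ [(s, b), (s, \<not> b)] @ v) (u @ v)"
| relator: "u \<in> group_words S \<Longrightarrow> v \<in> group_words S \<Longrightarrow> r \<in> R \<Longrightarrow> r \<in> group_words S \<Longrightarrow>
    word_equiv S R (u @ r @ v) (u @ v)"

definition word_rel :: "'s set \<Rightarrow> ('s \<times> bool) list set \<Rightarrow> (('s \<times> bool) list \<times> ('s \<times> bool) list) set" where
  "word_rel S R = {(u, v). word_equiv S R u v}"

definition presented_group :: "'s set \<Rightarrow> ('s \<times> bool) list set \<Rightarrow> ('s \<times> bool) list set monoid" where
  "presented_group S R =
     \<lparr>carrier = group_words S // word_rel S R,
      mult = (\<lambda>A B. \<Union>u\<in>A. \<Union>v\<in>B. word_rel S R `` {u @ v}),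
      one = word_rel S R `` {[]}\<rparr>"

definition presented_gen :: "'s set \<Rightarrow> ('s \<times> bool) list set \<Rightarrow> 's \<Rightarrow> ('s \<times> bool) list set" where
  "presented_gen S R s = word_rel S R `` {[(s, True)]}"

lemma word_equiv_in_words:
  "word_equiv S R u v \<Longrightarrow> u \<in> group_words S \<and> v \<in> group_words S"
  by (induction rule: word_equiv.induct) auto

lemma equiv_word_rel: "equiv (group_words S) (word_rel S R)"
proof (rule equivI)
  show "word_rel S R \<subseteq> group_words S \<times> group_words S"
    using word_equiv_in_words[of S R] unfolding word_rel_def by fast
  show "refl_on (group_words S) (word_rel S R)"
    unfolding refl_on_def word_rel_def using word_equiv.refl[of _ S R] by simp
  show "sym (word_rel S R)"
    unfolding sym_def word_rel_def using word_equiv.sym[of S R] by simp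
  show "trans (word_rel S R)"
    unfolding trans_def word_rel_def using word_equiv.trans[of S R] by fast
qed

lemma word_equiv_context:
  assumes "word_equiv S R u v" "a \<in> group_words S" "b \<in> group_words S"
  shows "word_equiv S R (a @ u @ b) (a @ v @ b)"
  using assms
proof (induction rule: word_equiv.induct)
  case (refl u)
  then show ?case by (intro word_equiv.refl) auto
next
  case (sym u v)
  show ?case by (rule word_equiv.sym) (rule sym.IH[OF sym.prems])
next
  case (trans u v w)
  show ?case
    by (rule word_equiv.trans[OF trans.IH(1)[OF trans.prems] trans.IH(2)[OF trans.prems]])
next
  case (cancel u v s c)
  then show ?case
    using word_equiv.cancel[of "a @ u" S "v @ b" s R c] by (simp add: image_Un)
next
  case (relator u v r)
  then show ?case
    using word_equiv.relator[of "a @ u" S "v @ b" r R] by (simp add: image_Un)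
qed

lemma word_equiv_append:
  assumes "word_equiv S R u u'" "word_equiv S R v v'"
  shows "word_equiv S R (u @ v) (u' @ v')"
proof -
  note w = word_equiv_in_words[OF assms(1)] word_equiv_in_words[OF assms(2)]
  have "word_equiv S R (u @ v) (u' @ v)"
    using word_equiv_context[OF assms(1), of "[]" v] w by simp
  moreover have "word_equiv S R (u' @ v) (u' @ v')"
    using word_equiv_context[OF assms(2), of u' "[]"] w by simp
  ultimately show ?thesis by (rule word_equiv.trans)
qed

lemma presented_group_mult:
  assumes "u \<in> group_words S" "v \<in> group_words S"
  shows "word_rel S R `` {u} \<otimes>\<^bsub>presented_group S R\<^esub> word_rel S R `` {v} = word_rel S R `` {u @ v}"
proof -
  have "word_rel S R `` {u' @ v'} = word_rel S R `` {u @ v}"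
    if "word_equiv S R u u'" "word_equiv S R v v'" for u' v'
    using equiv_class_eq[OF equiv_word_rel, of "u @ v" "u' @ v'" S R] word_equiv_append[OF that]
    by (simp add: word_rel_def)
  moreover have "word_equiv S R u u" "word_equiv S R v v"
    by (rule word_equiv.refl, fact)+
  ultimately have "(\<Union>u'\<in>word_rel S R `` {u}. \<Union>v'\<in>word_rel S R `` {v}. word_rel S R `` {u' @ v'})
      = word_rel S R `` {u @ v}"
    unfolding word_rel_def by fast
  then show ?thesis
    by (simp add: presented_group_def)
qed

lemma word_equiv_inverse:
  assumes "w \<in> group_words S"
  shows "word_equiv S R (rev (map (apsnd Not) w) @ w) []"
  using assms
proof (induction w)
  case Nil
  show ?case using word_equiv.refl[of "[]" S R] by simp
next
  case (Cons x w)
  obtain s b where x: "x = (s, b)" by force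
  have w: "w \<in> group_words S" "s \<in> S" "rev (map (apsnd Not) w) \<in> group_words S"
    using Cons.prems x by (auto simp: image_image)
  have "word_equiv S R (rev (map (apsnd Not) w) @ [(s, \<not> b), (s, \<not> \<not> b)] @ w)
     (rev (map (apsnd Not) w) @ w)"
    using w by (intro word_equiv.cancel) auto
  then show ?case
    using word_equiv.trans[OF _ Cons.IH[OF w(1)]] x by simp
qed

lemma group_presented_group: "group (presented_group S R)"
proof (rule groupI)
  let ?G = "presented_group S R"
  have repr: "\<exists>u\<in>group_words S. A = word_rel S R `` {u}" if "A \<in> carrier ?G" for A
    using that by (simp add: presented_group_def quotient_def)
  have cl: "word_rel S R `` {u} \<in> carrier ?G" if "u \<in> group_words S" for u
    using that by (auto simp: presented_group_def intro: quotientI)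
  have one: "\<one>\<^bsub>?G\<^esub> = word_rel S R `` {[]}"
    by (simp add: presented_group_def)
  show "A \<otimes>\<^bsub>?G\<^esub> B \<in> carrier ?G" if "A \<in> carrier ?G" "B \<in> carrier ?G" for A B
  proof -
    from repr that obtain u v where "u \<in> group_words S" "v \<in> group_words S"
      "A = word_rel S R `` {u}" "B = word_rel S R `` {v}" by meson
    then show ?thesis using cl[of "u @ v"] by (simp add: presented_group_mult image_Un)
  qed
  show "\<one>\<^bsub>?G\<^esub> \<in> carrier ?G"
    using cl[of "[]"] by (simp add: one)
  show "A \<otimes>\<^bsub>?G\<^esub> B \<otimes>\<^bsub>?G\<^esub> C = A \<otimes>\<^bsub>?G\<^esub> (B \<otimes>\<^bsub>?G\<^esub> C)"
    if "A \<in> carrier ?G" "B \<in> carrier ?G" "C \<in> carrier ?G" for A B C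
  proof -
    from repr that obtain u v w where "u \<in> group_words S" "v \<in> group_words S" "w \<in> group_words S"
      "A = word_rel S R `` {u}" "B = word_rel S R `` {v}" "C = word_rel S R `` {w}" by meson
    then show ?thesis by (simp add: presented_group_mult image_Un)
  qed
  show "\<one>\<^bsub>?G\<^esub> \<otimes>\<^bsub>?G\<^esub> A = A" if "A \<in> carrier ?G" for A
  proof -
    from repr[OF that] obtain u where u: "u \<in> group_words S" "A = word_rel S R `` {u}" by blast
    then show ?thesis using presented_group_mult[of "[]" S u R] by (simp add: one)
  qed
  show "\<exists>B\<in>carrier ?G. B \<otimes>\<^bsub>?G\<^esub> A = \<one>\<^bsub>?G\<^esub>" if "A \<in> carrier ?G" for A
  proof -
    from repr[OF that] obtain u where u: "u \<in> group_words S" "A = word_rel S R `` {u}" by blast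
    let ?v = "rev (map (apsnd Not) u)"
    have v: "?v \<in> group_words S"
      using u(1) by (auto simp: image_image)
    have "word_rel S R `` {?v @ u} = word_rel S R `` {[]}"
      using equiv_class_eq[OF equiv_word_rel, of "?v @ u" "[]" S R] word_equiv_inverse[OF u(1), of R]
      by (simp add: word_rel_def)
    then show ?thesis
      using presented_group_mult[OF v u(1), of R] cl[OF v] unfolding one u(2) by metis
  qed
qed


text \<open>The formal inverse of \<open>e\<close> is \<open>e\<close> itself, which gives a meaning to the closure of \<open>R\<close> under
  formal inversion for relators containing \<open>e\<close>.\<close>

locale symmetric_triangular =
  fixes S :: "'s set" and R :: "'s list set" and e :: 's and sinv :: "'s \<Rightarrow> 's"
  assumes finite_gens: "finite S"
    and finite_relators: "finite R"
    and e_in: "e \<in> S"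
    and sinv_in: "s \<in> S \<Longrightarrow> sinv s \<in> S"
    and sinv_e: "sinv e = e"
    and sinv_relator: "s \<in> S \<Longrightarrow> s \<noteq> e \<Longrightarrow> [s, sinv s, e] \<in> R"
    and relator_words: "r \<in> R \<Longrightarrow> length r = 3 \<and> set r \<subseteq> S"
    and relator_rotate1: "[a, b, c] \<in> R \<Longrightarrow> [b, c, a] \<in> R"
    and relator_rotate2: "[a, b, c] \<in> R \<Longrightarrow> [c, a, b] \<in> R"
    and relator_inverse: "[a, b, c] \<in> R \<Longrightarrow> [sinv c, sinv b, sinv a] \<in> R"
    and eee_relator: "[e, e, e] \<in> R"

text \<open>The letter \<open>e\<close> denotes the identity of the group. This is not a consequence of the
  length-three relators (sending every generator to 1 always defines a homomorphism onto the
  integers modulo 3), so the one-letter word \<open>e\<close> is imposed as a relator as well.\<close>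

definition tri_relators :: "'s list set \<Rightarrow> 's \<Rightarrow> ('s \<times> bool) list set" where
  "tri_relators R e = positive_word ` insert [e] R"

definition tri_group :: "'s set \<Rightarrow> 's list set \<Rightarrow> 's \<Rightarrow> ('s \<times> bool) list set monoid" where
  "tri_group S R e = presented_group S (tri_relators R e)"

definition tri_gen :: "'s set \<Rightarrow> 's list set \<Rightarrow> 's \<Rightarrow> 's \<Rightarrow> ('s \<times> bool) list set" where
  "tri_gen S R e s = presented_gen S (tri_relators R e) s"

lemma (in symmetric_triangular) tri_gen_e: "tri_gen S R e e = \<one>\<^bsub>tri_group S R e\<^esub>"
proof -
  let ?R = "tri_relators R e"
  have "word_equiv S ?R ([] @ [(e, True)] @ []) ([] @ [])"
    using e_in by (intro word_equiv.relator) (auto simp: tri_relators_def positive_word_def)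
  then have "([(e, True)], []) \<in> word_rel S ?R"
    by (simp add: word_rel_def)
  from equiv_class_eq[OF equiv_word_rel this] show ?thesis
    by (simp add: tri_gen_def tri_group_def presented_gen_def presented_group_def)
qed


text \<open>\<open>Joint i\<close> is \<open>b\<^sub>i\<close> and \<open>Elt s i\<close> is \<open>s\<^sub>i\<close>, for \<open>i\<close> in \<open>{1,2,3}\<close>.\<close>

datatype 's dowling_point = Joint nat | Elt 's nat

definition dowling_ground :: "'s set \<Rightarrow> 's dowling_point set" where
  "dowling_ground S = Joint ` {1, 2, 3} \<union> {Elt s i | s i. s \<in> S \<and> i \<in> {1, 2, 3}}"

definition dowling_lines :: "'s set \<Rightarrow> 's list set \<Rightarrow> 's dowling_point set set" where
  "dowling_lines S R =
     {{Joint 1, Joint 2} \<union> {Elt s 1 | s. s \<in> S},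
      {Joint 2, Joint 3} \<union> {Elt s 2 | s. s \<in> S},
      {Joint 3, Joint 1} \<union> {Elt s 3 | s. s \<in> S}} \<union>
     {{Elt s i, Elt s' j, Elt s'' k} | s s' s'' i j k.
        [s'', s', s] \<in> R \<and> (i, j, k) \<in> {(1, 2, 3), (2, 3, 1), (3, 1, 2)}}"

definition dowling_indep :: "'s set \<Rightarrow> 's list set \<Rightarrow> 's dowling_point set \<Rightarrow> bool" where
  "dowling_indep S R A \<longleftrightarrow>
     A \<subseteq> dowling_ground S \<and> finite A \<and>
     (card A \<le> 2 \<or> card A = 3 \<and> \<not> (\<exists>l\<in>dowling_lines S R. A \<subseteq> l))"

end

theory Submission
  imports Defs "HOL-Analysis.Product_Vector"
begin

text \<open>On \<open>V = W\<^sup>3\<close> let \<open>b\<^sub>i\<close> act as the coordinate \<open>v\<^sub>i\<close> and \<open>s\<^sub>i\<close> as \<open>v\<^sub>i\<^sub>+\<^sub>1 - \<rho> s v\<^sub>i\<close>, with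
  indices modulo 3. Two points of a line \<open>{b\<^sub>i, b\<^sub>i\<^sub>+\<^sub>1, s\<^sub>i, \<dots>}\<close> confine \<open>(v\<^sub>i, v\<^sub>i\<^sub>+\<^sub>1)\<close>
  to \<open>0\<close> or to the graph of some \<open>\<rho> s\<close> over its coincidence space with \<open>\<rho> s'\<close> for some \<open>s' \<noteq> s\<close>,
  which is small by (a). A third point of the line depends on this pair only, whereas a point off
  the line determines the remaining coordinate. Three points \<open>s\<^sub>1, s'\<^sub>2, s''\<^sub>3\<close> confine \<open>v\<^sub>1\<close> to the
  fixed space of \<open>\<rho> s'' \<rho> s' \<rho> s\<close>, which is small by (b) and (d) unless they form a relator line. On
  the common kernel of two points of a relator line the third map is \<open>w - \<rho> s'' \<rho> s' \<rho> s w\<close>, which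
  has small rank by (c). These kernel bounds suffice because the smallest rank of \<open>T\<^sub>x - L \<circ> T\<^sub>A\<close>
  over all linear \<open>L\<close> is the dimension of \<open>T\<^sub>x (ker T\<^sub>A)\<close>.\<close>

section \<open>Linear algebra\<close>

lemma vector_space_fun_scale:
  assumes "vector_space s"
  shows "vector_space (fun_scale s)"
proof -
  interpret vector_space s by fact
  show ?thesis
    by unfold_locales (auto simp: fun_scale_def fun_eq_iff scale_right_distrib scale_left_distrib)
qed

lemma finite_dimensional_vector_space_field:
  "finite_dimensional_vector_space ((*) :: 'f::field \<Rightarrow> 'f \<Rightarrow> 'f) {1}"
proof -
  interpret vector_space "(*) :: 'f \<Rightarrow> 'f \<Rightarrow> 'f"
    by unfold_locales (auto simp: algebra_simps)
  have "x \<in> span {1}" for x :: 'f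
    using span_scale[OF span_base[of 1 "{1}"], of x] by simp
  then show ?thesis
    by unfold_locales auto
qed

lemma (in vector_space_pair) dim_image_eq_of_inj:
  assumes f: "Vector_Spaces.linear s1 s2 f" and inj: "inj f"
  shows "vs2.dim (f ` S) = vs1.dim S"
proof -
  interpret f: Vector_Spaces.linear s1 s2 f by fact
  obtain B where B: "B \<subseteq> S" "vs1.independent B" "S \<subseteq> vs1.span B" "card B = vs1.dim S"
    by (rule vs1.basis_exists)
  have "card (f ` B) = vs2.dim (f ` S)"
    using B f.spans_image[OF B(3)] f.independent_inj_image[OF B(2) inj]
    by (intro vs2.basis_card_eq_dim) auto
  then show ?thesis
    using B(4) card_image[OF inj_on_subset[OF inj subset_UNIV], of B] by simp
qed

context finite_dimensional_vector_space_pair_1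
begin

lemma rank_nullity:
  assumes f: "Vector_Spaces.linear s1 s2 f" and U: "vs1.subspace U"
  shows "vs2.dim (f ` U) + vs1.dim {u \<in> U. f u = 0} = vs1.dim U"
proof -
  interpret f: Vector_Spaces.linear s1 s2 f by fact
  obtain h where h: "range h \<subseteq> U" "Vector_Spaces.linear s2 s1 h" "\<forall>w\<in>f ` U. f (h w) = w"
    using linear_exists_right_inverse_on[OF f U] by blast
  interpret h: Vector_Spaces.linear s2 s1 h by (rule h(2))
  define K where "K = {u \<in> U. f u = 0}"
  define H where "H = h ` f ` U"
  have K: "vs1.subspace K"
    unfolding K_def by (auto simp: vs1.subspace_def f.add f.scale vs1.subspace_0[OF U]
        intro: vs1.subspace_add[OF U] vs1.subspace_scale[OF U])
  have H: "vs1.subspace H"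
    unfolding H_def by (intro h.subspace_image f.subspace_image U)
  have "K \<inter> H = {0}"
    using h(3) vs1.subspace_0[OF K] vs1.subspace_0[OF H] by (auto simp: K_def H_def)
  moreover have "{x + y |x y. x \<in> K \<and> y \<in> H} = U"
  proof (intro equalityI subsetI)
    fix u assume u: "u \<in> U"
    have "u - h (f u) \<in> K" "h (f u) \<in> H"
      using u h(1,3) by (auto simp: K_def H_def f.diff intro!: vs1.subspace_diff[OF U])
    then have "(u - h (f u)) + h (f u) \<in> {x + y |x y. x \<in> K \<and> y \<in> H}" by blast
    then show "u \<in> {x + y |x y. x \<in> K \<and> y \<in> H}" by simp
  qed (use h(1) in \<open>auto simp: K_def H_def intro!: vs1.subspace_add[OF U]\<close>)
  ultimately have "vs1.dim U = vs1.dim K + vs1.dim H"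
    using vs1.dim_sums_Int[OF K H] by simp
  moreover have "inj_on f (vs1.span H)"
    unfolding vs1.span_eq_iff[THEN iffD2, OF H] using h(3) by (auto simp: H_def intro!: inj_onI)
  then have "vs2.dim (f ` H) = vs1.dim H"
    by (rule dim_image_eq[OF f])
  moreover have "f ` H = f ` U"
    using h(3) by (force simp: H_def image_image)
  ultimately show ?thesis by (simp add: K_def)
qed

corollary dim_image_eq_of_trivial_kernel:
  assumes "Vector_Spaces.linear s1 s2 f" "vs1.subspace U" "\<And>u. u \<in> U \<Longrightarrow> f u = 0 \<Longrightarrow> u = 0"
  shows "vs2.dim (f ` U) = vs1.dim U"
proof -
  have "{u \<in> U. f u = 0} \<subseteq> {0}" using assms(3) by blast
  then show ?thesis
    using rank_nullity[OF assms(1,2)] vs1.dim_eq_0[of "{u \<in> U. f u = 0}"] by linarith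
qed

end

lemma exists_linear_range_diff_eq:
  assumes f: "Vector_Spaces.linear s1 s3 f" and g: "Vector_Spaces.linear s1 s2 g"
  shows "\<exists>L. Vector_Spaces.linear s2 s3 L \<and> range (\<lambda>v. f v - L (g v)) = f ` {v. g v = 0}"
proof -
  interpret f: Vector_Spaces.linear s1 s3 f by fact
  interpret g: Vector_Spaces.linear s1 s2 g by fact
  interpret vector_space_pair s1 s2 by unfold_locales
  obtain h where h: "Vector_Spaces.linear s2 s1 h" "\<forall>w\<in>range g. g (h w) = w"
    using linear_exists_right_inverse_on[OF g f.vs1.subspace_UNIV] by blast
  interpret h: Vector_Spaces.linear s2 s1 h by (rule h(1))
  have "range (\<lambda>v. f v - f (h (g v))) = f ` {v. g v = 0}"
  proof (intro equalityI image_subsetI)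
    fix v
    have "g (v - h (g v)) = 0" using h(2) by (simp add: g.diff)
    then show "f v - f (h (g v)) \<in> f ` {v. g v = 0}"
      unfolding f.diff[symmetric] by blast
  next
    fix v assume "v \<in> {v. g v = 0}"
    then have "f v = f v - f (h (g v))" by (simp add: h.zero f.zero)
    then show "f v \<in> range (\<lambda>v. f v - f (h (g v)))" by (rule range_eqI)
  qed
  then show ?thesis
    using Vector_Spaces.linear_compose[OF h(1) f] by (intro exI[of _ "f \<circ> h"]) simp
qed

lemma (in finite_dimensional_vector_space) exists_linear_embedding_in_sequences:
  "\<exists>\<phi>. Vector_Spaces.linear scale (fun_scale (*)) \<phi> \<and> inj (\<phi> :: 'b \<Rightarrow> nat \<Rightarrow> 'a)"
proof -
  obtain f :: "'b \<Rightarrow> nat" where f: "inj_on f Basis"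
    using finite_imp_inj_to_nat_seg[OF finite_Basis] by blast
  interpret field: finite_dimensional_vector_space "(*) :: 'a \<Rightarrow> 'a \<Rightarrow> 'a" "{1}"
    by (rule finite_dimensional_vector_space_field)
  define \<phi> :: "'b \<Rightarrow> nat \<Rightarrow> 'a"
    where "\<phi> w = (\<lambda>n. if n \<in> f ` Basis then representation Basis w (inv_into Basis f n) else 0)"
    for w
  have "Vector_Spaces.linear scale (fun_scale (*)) \<phi>"
    unfolding Vector_Spaces.linear_iff
    using vector_space_axioms vector_space_fun_scale[OF field.vector_space_axioms]
    by (auto simp: \<phi>_def fun_eq_iff fun_scale_def span_Basis
        representation_add[OF independent_Basis] representation_scale[OF independent_Basis])
  moreover have "inj \<phi>"
  proof (rule injI)
    fix v w assume eq: "\<phi> v = \<phi> w"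
    have "representation Basis v b = representation Basis w b" if "b \<in> Basis" for b
      using fun_cong[OF eq, of "f b"] that f by (simp add: \<phi>_def)
    then have "(\<Sum>b\<in>Basis. scale (representation Basis v b) b)
        = (\<Sum>b\<in>Basis. scale (representation Basis w b) b)"
      by simp
    then show "v = w"
      by (simp add: sum_representation_eq[OF independent_Basis _ finite_Basis] span_Basis)
  qed
  ultimately show ?thesis by blast
qed

section \<open>Rank distance\<close>

lemma d_rk_nonneg: "0 \<le> d_rk s f g"
  by (simp add: d_rk_def)

context finite_dimensional_vector_space
begin

lemma d_rk_self: "d_rk scale f f = 0"
  by (simp add: d_rk_def rk_def)

text \<open>In dimension \<open>0\<close> the quotient defining \<^const>\<open>d_rk\<close> is \<open>0 / 0 = 0\<close>.\<close>

lemma rk_diff_eq_d_rk: "real (rk scale UNIV (\<lambda>x. f x - g x)) = d_rk scale f g * dimension"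
proof (cases "dimension = 0")
  case True
  then show ?thesis
    using dim_subset_UNIV[of "range (\<lambda>x. f x - g x)"] by (simp add: rk_def)
qed (simp add: d_rk_def dimension_def)

lemma dim_coincidence_eq_d_rk:
  assumes f: "Vector_Spaces.linear scale scale f" and g: "Vector_Spaces.linear scale scale g"
  shows "real (dim {x. f x = g x}) = (1 - d_rk scale f g) * dimension"
proof -
  interpret finite_dimensional_vector_space_pair_1 scale Basis scale by unfold_locales
  have "dim (range (\<lambda>x. f x - g x)) + dim {x. f x = g x} = dimension"
    using rank_nullity[OF linear_compose_sub[OF f g] subspace_UNIV] by (simp add: dimension_def)
  then have "real (rk scale UNIV (\<lambda>x. f x - g x)) + real (dim {x. f x = g x}) = real dimension"
    by (simp add: rk_def flip: of_nat_add)
  then show ?thesis by (simp add: rk_diff_eq_d_rk algebra_simps)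
qed

end

section \<open>Approximate representations\<close>

lemma linear_map_on_of_linear:
  assumes "Vector_Spaces.linear s1 s2 f" "f ` U \<subseteq> V"
  shows "linear_map_on s1 s2 U V f"
  using assms by (auto simp: linear_map_on_def Vector_Spaces.linear_iff)

lemma linear_map_on_compose:
  assumes "linear_map_on s1 s2 U V f" "linear_map_on s2 s3 V W g"
  shows "linear_map_on s1 s3 U W (g \<circ> f)"
  using assms unfolding linear_map_on_def image_subset_iff by simp

lemma linear_fun_scale_compose:
  assumes "Vector_Spaces.linear s1 s2 f"
  shows "Vector_Spaces.linear (fun_scale s1) (fun_scale s2) ((\<circ>) f)"
  using assms vector_space_fun_scale[of s1] vector_space_fun_scale[of s2]
  by (auto simp: Vector_Spaces.linear_iff fun_scale_def fun_eq_iff)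

lemma fin_dim_space_linear_image:
  assumes V: "fin_dim_space s1 V" and f: "Vector_Spaces.linear s1 s2 f"
  shows "fin_dim_space s2 (f ` V)"
proof -
  interpret f: Vector_Spaces.linear s1 s2 f by fact
  obtain B where "finite B" "f.vs1.span B = V"
    using V by (auto simp: fin_dim_space_def)
  then have "finite (f ` B)" "f.vs2.span (f ` B) = f ` V"
    by (simp_all add: f.span_image)
  then show ?thesis
    using V f.subspace_image f.vs2.vector_space_axioms unfolding fin_dim_space_def by blast
qed

lemma (in finite_dimensional_vector_space) fin_dim_space_UNIV: "fin_dim_space scale UNIV"
  using vector_space_axioms finite_Basis span_Basis by (auto simp: fin_dim_space_def)

lemma rk_compose_inj:
  assumes "Vector_Spaces.linear s1 s2 \<phi>" "inj \<phi>"
  shows "rk s2 X (\<lambda>v. \<phi> (f v)) = rk s1 X f"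
proof -
  interpret \<phi>: Vector_Spaces.linear s1 s2 \<phi> by fact
  interpret vector_space_pair s1 s2 by unfold_locales
  show ?thesis
    using dim_image_eq_of_inj[OF assms, of "f ` X"] by (simp add: rk_def image_image)
qed

lemma rk_image: "rk s (h ` X) f = rk s X (\<lambda>v. f (h v))"
  by (simp add: rk_def image_image)

lemma linear_map_on_transport:
  assumes L: "linear_map_on s1 s2 U V L"
    and f: "Vector_Spaces.linear s1 s1' f" "inj f"
    and g: "Vector_Spaces.linear s2 s2' g"
  shows "\<exists>L'. linear_map_on s1' s2' (f ` U) (g ` V) L' \<and> (\<forall>u. L' (f u) = g (L u))"
proof -
  interpret f: Vector_Spaces.linear s1 s1' f by (rule f(1))
  interpret vector_space_pair s1 s1' by unfold_locales
  obtain h where h: "Vector_Spaces.linear s1' s1 h" "\<And>u. h (f u) = u"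
    using linear_injective_left_inverse[OF f] by (auto simp: fun_eq_iff)
  have "linear_map_on s1' s1 (f ` U) U h" "linear_map_on s2 s2' V (g ` V) g"
    using h g by (auto simp: image_image intro: linear_map_on_of_linear)
  then have "linear_map_on s1' s2' (f ` U) (g ` V) (g \<circ> (L \<circ> h))"
    using L by (blast intro: linear_map_on_compose)
  then show ?thesis
    using h(2) by (intro exI[of _ "g \<circ> (L \<circ> h)"]) simp
qed

lemma direct_sum_image:
  assumes "\<phi> 0 = 0"
  shows "direct_sum A (\<lambda>i. \<phi> ` W i) = (\<circ>) \<phi> ` direct_sum A W"
proof (intro equalityI subsetI)
  fix u assume u: "u \<in> direct_sum A (\<lambda>i. \<phi> ` W i)"
  then have "\<forall>i\<in>A. \<exists>w. w \<in> W i \<and> u i = \<phi> w" by (auto simp: direct_sum_def)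
  then obtain w where w: "\<forall>i\<in>A. w i \<in> W i \<and> u i = \<phi> (w i)" by metis
  then have "(\<lambda>i. if i \<in> A then w i else 0) \<in> direct_sum A W"
      "u = \<phi> \<circ> (\<lambda>i. if i \<in> A then w i else 0)"
    using u assms by (auto simp: direct_sum_def)
  then show "u \<in> (\<circ>) \<phi> ` direct_sum A W" by blast
qed (use assms in \<open>auto simp: direct_sum_def\<close>)

definition approx_determined ::
  "('f::field \<Rightarrow> 'w::ab_group_add \<Rightarrow> 'w) \<Rightarrow> 'v set \<Rightarrow> ('e \<Rightarrow> 'w set) \<Rightarrow> ('e \<Rightarrow> 'v \<Rightarrow> 'w) \<Rightarrow>
   'e set \<Rightarrow> 'e \<Rightarrow> real \<Rightarrow> bool" where
  "approx_determined sW V W T A x d \<longleftrightarrow>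
     (\<exists>L. linear_map_on (fun_scale sW) sW (direct_sum A W) (W x) L \<and>
          real (rk sW V (\<lambda>v. T x v - L (joint_map T A v))) \<le> d)"

lemma approx_representation_iff:
  "approx_representation sV sW E indep \<epsilon> c V W T \<longleftrightarrow>
     c > 0 \<and> fin_dim_space sV V \<and>
     (\<forall>x\<in>E. fin_dim_space sW (W x) \<and> vector_space.dim sW (W x) = c) \<and>
     (\<forall>x\<in>E. linear_map_on sV sW V (W x) (T x) \<and> T x ` V = W x) \<and>
     (\<forall>A. A \<subseteq> E \<and> indep A \<longrightarrow>
        real (rk (fun_scale sW) V (joint_map T A)) \<ge> real c * (real (card A) - \<epsilon>)) \<and>
     (\<forall>C x. circuit E indep C \<and> x \<in> C \<longrightarrow> approx_determined sW V W T (C - {x}) x (real c * \<epsilon>))"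
  unfolding approx_representation_def approx_determined_def ..

lemma joint_map_transport:
  assumes "\<And>i. i \<in> A \<Longrightarrow> T' i v' = \<phi> (T i v)" "\<phi> 0 = 0"
  shows "joint_map T' A v' = \<phi> \<circ> joint_map T A v"
proof
  show "joint_map T' A v' i = (\<phi> \<circ> joint_map T A v) i" for i
    using assms by (cases "i \<in> A") (simp_all add: joint_map_def)
qed

lemma approx_determined_linear_image:
  assumes det: "approx_determined sW V W T A x d"
    and \<phi>: "Vector_Spaces.linear sW sW' \<phi>" "inj \<phi>"
    and T': "\<And>i v. i \<in> insert x A \<Longrightarrow> T' i (\<iota> v) = \<phi> (T i v)"
  shows "approx_determined sW' (\<iota> ` V) (\<lambda>i. \<phi> ` W i) T' A x d"
proof -
  interpret \<phi>: Vector_Spaces.linear sW sW' \<phi> by (rule \<phi>(1))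
  obtain L where L: "linear_map_on (fun_scale sW) sW (direct_sum A W) (W x) L"
      "real (rk sW V (\<lambda>v. T x v - L (joint_map T A v))) \<le> d"
    using det by (auto simp: approx_determined_def)
  obtain L' where L': "\<And>u. L' (\<phi> \<circ> u) = \<phi> (L u)"
      "linear_map_on (fun_scale sW') sW' (direct_sum A (\<lambda>i. \<phi> ` W i)) (\<phi> ` W x) L'"
    using linear_map_on_transport
        [OF L(1) linear_fun_scale_compose[OF \<phi>(1)] fun.inj_map[OF \<phi>(2)] \<phi>(1)]
      direct_sum_image[of \<phi> A W] \<phi>.zero by auto
  have "joint_map T' A (\<iota> v) = \<phi> \<circ> joint_map T A v" for v
    using T' \<phi>.zero by (intro joint_map_transport) auto
  then have "T' x (\<iota> v) - L' (joint_map T' A (\<iota> v)) = \<phi> (T x v - L (joint_map T A v))" for v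
    by (simp only: T'[OF insertI1] L'(1) \<phi>.diff)
  then have "rk sW' (\<iota> ` V) (\<lambda>v. T' x v - L' (joint_map T' A v))
      = rk sW V (\<lambda>v. T x v - L (joint_map T A v))"
    by (simp add: rk_image rk_compose_inj[OF \<phi>])
  then show ?thesis
    using L(2) L'(2) unfolding approx_determined_def by (intro exI[of _ L']) simp
qed

lemma approx_representation_linear_image:
  assumes rep: "approx_representation sV sW E indep \<epsilon> c V W T"
    and \<iota>: "Vector_Spaces.linear sV sV' \<iota>" "inj \<iota>"
    and \<phi>: "Vector_Spaces.linear sW sW' \<phi>" "inj \<phi>"
  shows "\<exists>T'. approx_representation sV' sW' E indep \<epsilon> c (\<iota> ` V) (\<lambda>x. \<phi> ` W x) T'"
proof -
  interpret \<phi>: Vector_Spaces.linear sW sW' \<phi> by (rule \<phi>(1))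
  interpret vector_space_pair sW sW' by unfold_locales
  have "\<exists>f. linear_map_on sV' sW' (\<iota> ` V) (\<phi> ` W x) f \<and> (\<forall>v. f (\<iota> v) = \<phi> (T x v))"
    if "x \<in> E" for x
    using rep that by (intro linear_map_on_transport[OF _ \<iota> \<phi>(1)])
      (simp add: approx_representation_iff)
  then obtain T' where T'_linear: "\<And>x. x \<in> E \<Longrightarrow> linear_map_on sV' sW' (\<iota> ` V) (\<phi> ` W x) (T' x)"
    and T'_\<iota>: "\<And>x v. x \<in> E \<Longrightarrow> T' x (\<iota> v) = \<phi> (T x v)"
    by metis
  have "approx_representation sV' sW' E indep \<epsilon> c (\<iota> ` V) (\<lambda>x. \<phi> ` W x) T'"
    unfolding approx_representation_iff
  proof (intro conjI ballI allI impI)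
    show "c > 0" "fin_dim_space sV' (\<iota> ` V)"
      using rep \<iota>(1) by (auto simp: approx_representation_iff intro: fin_dim_space_linear_image)
  next
    fix x assume x: "x \<in> E"
    show "fin_dim_space sW' (\<phi> ` W x)" "vector_space.dim sW' (\<phi> ` W x) = c"
      using rep x \<phi>(1) dim_image_eq_of_inj[OF \<phi>]
      by (auto simp: approx_representation_iff intro: fin_dim_space_linear_image)
    show "linear_map_on sV' sW' (\<iota> ` V) (\<phi> ` W x) (T' x)" by (rule T'_linear[OF x])
    have "T' x ` \<iota> ` V = \<phi> ` T x ` V" by (simp add: image_image T'_\<iota>[OF x])
    then show "T' x ` \<iota> ` V = \<phi> ` W x" using rep x by (simp add: approx_representation_iff)
  next
    fix A assume A: "A \<subseteq> E \<and> indep A"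
    then have "joint_map T' A (\<iota> v) = \<phi> \<circ> joint_map T A v" for v
      using T'_\<iota> \<phi>.zero by (intro joint_map_transport) auto
    then have "rk (fun_scale sW') (\<iota> ` V) (joint_map T' A) = rk (fun_scale sW) V (joint_map T A)"
      using rk_compose_inj[OF linear_fun_scale_compose[OF \<phi>(1)] fun.inj_map[OF \<phi>(2)]]
      by (simp add: rk_image)
    then show "real c * (real (card A) - \<epsilon>) \<le> real (rk (fun_scale sW') (\<iota> ` V) (joint_map T' A))"
      using rep A by (simp add: approx_representation_iff)
  next
    fix C x assume C: "circuit E indep C \<and> x \<in> C"
    then have "insert x (C - {x}) \<subseteq> E" by (auto simp: circuit_def)
    then have T'_C: "T' i (\<iota> v) = \<phi> (T i v)" if "i \<in> insert x (C - {x})" for i v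
      using T'_\<iota> that by blast
    have "approx_determined sW V W T (C - {x}) x (real c * \<epsilon>)"
      using rep C by (simp add: approx_representation_iff)
    then show "approx_determined sW' (\<iota> ` V) (\<lambda>x. \<phi> ` W x) T' (C - {x}) x (real c * \<epsilon>)"
      by (rule approx_determined_linear_image[where T = T and T' = T' and \<iota> = \<iota>, OF _ \<phi> T'_C])
  qed
  then show ?thesis by blast
qed

lemma has_approx_representationI:
  assumes rep: "approx_representation sV sW E indep \<epsilon> c UNIV (\<lambda>_. UNIV) T"
    and V: "finite_dimensional_vector_space sV BV"
    and W: "finite_dimensional_vector_space (sW :: 'f::field \<Rightarrow> _) BW"
  shows "has_approx_representation TYPE('f) E indep \<epsilon>"
proof -
  obtain \<iota> where "Vector_Spaces.linear sV (fun_scale (*)) \<iota>" "inj (\<iota> :: _ \<Rightarrow> nat \<Rightarrow> 'f)"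
    using finite_dimensional_vector_space.exists_linear_embedding_in_sequences[OF V] by blast
  moreover obtain \<phi> where "Vector_Spaces.linear sW (fun_scale (*)) \<phi>" "inj (\<phi> :: _ \<Rightarrow> nat \<Rightarrow> 'f)"
    using finite_dimensional_vector_space.exists_linear_embedding_in_sequences[OF W] by blast
  ultimately show ?thesis
    using approx_representation_linear_image[OF rep]
    unfolding has_approx_representation_def by blast
qed

lemma approx_determined_mono:
  "approx_determined sW V W T A x d \<Longrightarrow> d \<le> d' \<Longrightarrow> approx_determined sW V W T A x d'"
  unfolding approx_determined_def by (meson order.trans)

lemma approx_representation_mono:
  assumes rep: "approx_representation sV sW E indep \<epsilon> c V W T" and le: "\<epsilon> \<le> \<delta>"
  shows "approx_representation sV sW E indep \<delta> c V W T"
  unfolding approx_representation_iff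
proof (intro conjI allI impI)
  fix A assume "A \<subseteq> E \<and> indep A"
  then have "real c * (real (card A) - \<epsilon>) \<le> real (rk (fun_scale sW) V (joint_map T A))"
    using rep by (simp add: approx_representation_iff)
  moreover have "real c * (real (card A) - \<delta>) \<le> real c * (real (card A) - \<epsilon>)"
    using le by (intro mult_left_mono) auto
  ultimately show "real c * (real (card A) - \<delta>) \<le> real (rk (fun_scale sW) V (joint_map T A))"
    by linarith
next
  fix C x assume "circuit E indep C \<and> x \<in> C"
  then have "approx_determined sW V W T (C - {x}) x (real c * \<epsilon>)"
    using rep by (simp add: approx_representation_iff)
  then show "approx_determined sW V W T (C - {x}) x (real c * \<delta>)"
    by (rule approx_determined_mono) (use le in \<open>simp add: mult_left_mono\<close>)
qed (use rep in \<open>simp_all add: approx_representation_iff\<close>)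

lemma has_approx_representation_mono:
  assumes "has_approx_representation TYPE('f::field) E indep \<epsilon>" "\<epsilon> \<le> \<delta>"
  shows "has_approx_representation TYPE('f) E indep \<delta>"
  using assms unfolding has_approx_representation_def by (blast intro: approx_representation_mono)

definition common_kernel :: "('i \<Rightarrow> 'v \<Rightarrow> 'w::zero) \<Rightarrow> 'i set \<Rightarrow> 'v set" where
  "common_kernel T A = {v. \<forall>i\<in>A. T i v = 0}"

lemma joint_map_eq_0_iff: "joint_map T A v = 0 \<longleftrightarrow> v \<in> common_kernel T A"
  by (auto simp: joint_map_def common_kernel_def fun_eq_iff)

lemma common_kernel_insert: "common_kernel T (insert i A) = {v \<in> common_kernel T A. T i v = 0}"
  by (auto simp: common_kernel_def)

lemma linear_joint_map:
  assumes "vector_space s1" "vector_space s2" "\<And>i. i \<in> A \<Longrightarrow> Vector_Spaces.linear s1 s2 (T i)"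
  shows "Vector_Spaces.linear s1 (fun_scale s2) (joint_map T A)"
proof -
  interpret vector_space s2 by fact
  show ?thesis
    using assms vector_space_fun_scale[of s2]
    by (auto simp: Vector_Spaces.linear_iff joint_map_def fun_scale_def fun_eq_iff)
qed

lemma subspace_common_kernel:
  assumes "vector_space s1" "vector_space s2" "\<And>i. i \<in> A \<Longrightarrow> Vector_Spaces.linear s1 s2 (T i)"
  shows "module.subspace s1 (common_kernel T A)"
proof -
  interpret vector_space_pair s1 "fun_scale s2"
    using assms(1,2) by (simp add: vector_space_pair_def vector_space_fun_scale)
  show ?thesis
    using linear_subspace_kernel[OF linear_joint_map[OF assms]] by (simp add: joint_map_eq_0_iff)
qed

lemma approx_determined_of_common_kernel:
  assumes "vector_space sV" "vector_space sW"
    and linear: "\<And>i. i \<in> insert x A \<Longrightarrow> Vector_Spaces.linear sV sW (T i)"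
    and dim: "real (vector_space.dim sW (T x ` common_kernel T A)) \<le> d"
  shows "approx_determined sW UNIV (\<lambda>_. UNIV) T A x d"
proof -
  have "Vector_Spaces.linear sV (fun_scale sW) (joint_map T A)"
    using assms(1,2) linear by (intro linear_joint_map) auto
  from exists_linear_range_diff_eq[OF linear[OF insertI1] this]
  obtain L where "Vector_Spaces.linear (fun_scale sW) sW L"
    "range (\<lambda>v. T x v - L (joint_map T A v)) = T x ` common_kernel T A"
    unfolding joint_map_eq_0_iff Collect_mem_eq by blast
  then show ?thesis
    using dim unfolding approx_determined_def rk_def
    by (intro exI[of _ L]) (simp add: linear_map_on_of_linear)
qed

lemma approx_representation_of_common_kernels:
  assumes V: "finite_dimensional_vector_space sV BV"
    and W: "finite_dimensional_vector_space sW BW" and BW: "BW \<noteq> {}"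
    and linear: "\<And>x. x \<in> E \<Longrightarrow> Vector_Spaces.linear sV sW (T x)"
    and surj: "\<And>x. x \<in> E \<Longrightarrow> surj (T x)"
    and indep: "\<And>A. A \<subseteq> E \<Longrightarrow> indep A \<Longrightarrow>
      real (vector_space.dim sV (common_kernel T A))
        \<le> real (card BV) - real (card BW) * (real (card A) - \<epsilon>)"
    and circuit: "\<And>C x. circuit E indep C \<Longrightarrow> x \<in> C \<Longrightarrow>
      real (vector_space.dim sW (T x ` common_kernel T (C - {x}))) \<le> real (card BW) * \<epsilon>"
  shows "approx_representation sV sW E indep \<epsilon> (card BW) UNIV (\<lambda>_. UNIV) T"
proof -
  interpret V: finite_dimensional_vector_space sV BV by fact
  interpret W: finite_dimensional_vector_space sW BW by fact
  interpret families: vector_space "fun_scale sW"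
    by (rule vector_space_fun_scale[OF W.vector_space_axioms])
  interpret finite_dimensional_vector_space_pair_1 sV BV "fun_scale sW" by unfold_locales
  show ?thesis
    unfolding approx_representation_iff
  proof (intro conjI ballI allI impI)
    show "card BW > 0" using BW W.finite_Basis by (simp add: card_gt_0_iff)
    show "linear_map_on sV sW UNIV UNIV (T x)" if "x \<in> E" for x
      using linear[OF that] by (intro linear_map_on_of_linear) auto
  next
    fix A assume A: "A \<subseteq> E \<and> indep A"
    then have "Vector_Spaces.linear sV (fun_scale sW) (joint_map T A)"
      by (intro linear_joint_map V.vector_space_axioms W.vector_space_axioms linear) auto
    from rank_nullity[OF this V.subspace_UNIV]
    have "rk (fun_scale sW) UNIV (joint_map T A) + V.dim (common_kernel T A) = card BV"
      by (simp add: rk_def joint_map_eq_0_iff)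
    then show "real (card BW) * (real (card A) - \<epsilon>) \<le> real (rk (fun_scale sW) UNIV (joint_map T A))"
      using indep[of A] A by linarith
  next
    fix C x assume C: "circuit E indep C \<and> x \<in> C"
    then have "insert x (C - {x}) \<subseteq> E" by (auto simp: circuit_def)
    then show "approx_determined sW UNIV (\<lambda>_. UNIV) T (C - {x}) x (real (card BW) * \<epsilon>)"
      using C circuit linear
      by (intro approx_determined_of_common_kernel[where sV = sV]
          V.vector_space_axioms W.vector_space_axioms) auto
  qed (simp_all add: V.fin_dim_space_UNIV W.fin_dim_space_UNIV surj)
qed

section \<open>Points and lines of the Dowling geometry\<close>

definition next_index :: "nat \<Rightarrow> nat" where
  "next_index i = i mod 3 + 1"

lemma next_index_simps [simp]:
  "next_index (Suc 0) = 2" "next_index 1 = 2" "next_index 2 = 3" "next_index 3 = 1"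
  by (simp_all add: next_index_def)

lemma next_index_mem: "next_index i \<in> {1, 2, 3}"
  using mod_less_divisor[of 3 i] by (simp add: next_index_def) linarith

lemma next_index_cycle: "i \<in> {1, 2, 3} \<Longrightarrow> next_index (next_index (next_index i)) = i"
  by auto

definition joint_line :: "'s set \<Rightarrow> nat \<Rightarrow> 's dowling_point set" where
  "joint_line S i = {Joint i, Joint (next_index i)} \<union> {Elt s i | s. s \<in> S}"

definition relator_line :: "'s \<Rightarrow> 's \<Rightarrow> 's \<Rightarrow> nat \<Rightarrow> 's dowling_point set" where
  "relator_line s s' s'' i =
     {Elt s i, Elt s' (next_index i), Elt s'' (next_index (next_index i))}"

lemma Joint_in_dowling_ground [simp]: "Joint i \<in> dowling_ground S \<longleftrightarrow> i \<in> {1, 2, 3}"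
  by (auto simp: dowling_ground_def)

lemma Elt_in_dowling_ground [simp]: "Elt s i \<in> dowling_ground S \<longleftrightarrow> s \<in> S \<and> i \<in> {1, 2, 3}"
  by (auto simp: dowling_ground_def)

lemma Joint_in_joint_line [simp]: "Joint j \<in> joint_line S i \<longleftrightarrow> j = i \<or> j = next_index i"
  by (auto simp: joint_line_def)

lemma Elt_in_joint_line [simp]: "Elt s j \<in> joint_line S i \<longleftrightarrow> s \<in> S \<and> j = i"
  by (auto simp: joint_line_def)

lemma Joint_notin_relator_line [simp]: "Joint j \<notin> relator_line s s' s'' i"
  by (simp add: relator_line_def)

lemma relator_line_rotate:
  assumes "i \<in> {1, 2, 3}"
  shows "relator_line s' s'' s (next_index i) = relator_line s s' s'' i"
  unfolding relator_line_def next_index_cycle[OF assms] by blast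

lemma dowling_lines_eq:
  "dowling_lines S R = joint_line S ` {1, 2, 3} \<union>
     {relator_line s s' s'' i | s s' s'' i. [s'', s', s] \<in> R \<and> i \<in> {1, 2, 3}}"
proof -
  have "(i, j, k) \<in> {(1, 2, 3), (2, 3, 1), (3, 1, 2)} \<longleftrightarrow>
      i \<in> {1, 2, 3} \<and> j = next_index i \<and> k = next_index (next_index i)" for i j k
    by auto
  then have relator_lines: "{{Elt s i, Elt s' j, Elt s'' k} | s s' s'' i j k.
        [s'', s', s] \<in> R \<and> (i, j, k) \<in> {(1, 2, 3), (2, 3, 1), (3, 1, 2)}} =
      {relator_line s s' s'' i | s s' s'' i. [s'', s', s] \<in> R \<and> i \<in> {1, 2, 3}}"
    unfolding relator_line_def by (simp del: insert_iff)
  have joint_lines: "{{Joint 1, Joint 2} \<union> {Elt s 1 | s. s \<in> S},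
      {Joint 2, Joint 3} \<union> {Elt s 2 | s. s \<in> S},
      {Joint 3, Joint 1} \<union> {Elt s 3 | s. s \<in> S}} = joint_line S ` {1, 2, 3}"
    by (simp add: joint_line_def)
  show ?thesis
    unfolding dowling_lines_def joint_lines relator_lines ..
qed

lemma dowling_lines_cases:
  assumes "l \<in> dowling_lines S R"
  obtains (joint) i where "i \<in> {1, 2, 3}" "l = joint_line S i"
    | (relator) s s' s'' i where "[s'', s', s] \<in> R" "i \<in> {1, 2, 3}" "l = relator_line s s' s'' i"
  using assms unfolding dowling_lines_eq by blast

lemma joint_lines_meet_in_one_point:
  assumes "i \<in> {1, 2, 3}" "j \<in> {1, 2, 3}" "i \<noteq> j"
    and "x \<in> joint_line S i \<inter> joint_line S j" "y \<in> joint_line S i \<inter> joint_line S j"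
  shows "x = y"
proof -
  have joint_eq: "a = b"
    if "a \<in> {i, next_index i} \<inter> {j, next_index j}" "b \<in> {i, next_index i} \<inter> {j, next_index j}"
    for a b
    using assms(1-3) that by (elim IntE insertE emptyE) simp_all
  show ?thesis
    using assms(3-5) by (cases x; cases y) (auto intro: joint_eq)
qed

lemma dowling_line_through_joint_pair:
  assumes i: "i \<in> {1, 2, 3}" and A: "card A = 2" "A \<subseteq> joint_line S i"
    and l: "l \<in> dowling_lines S R" "A \<subseteq> l" "Joint j \<in> l"
  shows "l = joint_line S i"
  using l(1)
proof (cases rule: dowling_lines_cases)
  case (joint k)
  obtain y z where "A = {y, z}" "y \<noteq> z" using A(1) by (auto simp: card_2_iff)
  then have "k = i"
    using joint_lines_meet_in_one_point[OF i joint(1), of y S z] A(2) l(2) joint(2) by blast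
  then show ?thesis using joint(2) by simp
next
  case relator
  then show ?thesis using l(3) by simp
qed

lemma dowling_indep_insert:
  assumes A: "dowling_indep S R A" and card: "card A < 3" and x: "x \<in> dowling_ground S" "x \<notin> A"
    and no_line: "\<And>l. card A = 2 \<Longrightarrow> l \<in> dowling_lines S R \<Longrightarrow> \<not> insert x A \<subseteq> l"
  shows "dowling_indep S R (insert x A)"
  using assms unfolding dowling_indep_def by (cases "card A = 2") auto

lemma dowling_indep_extend:
  assumes A: "dowling_indep S R A" and card: "card A < 3"
  obtains x where "x \<in> dowling_ground S" "x \<notin> A" "dowling_indep S R (insert x A)"
proof (cases "\<exists>i\<in>{1, 2, 3}. card A = 2 \<and> A \<subseteq> joint_line S i")
  case True
  then obtain i where i: "i \<in> {1, 2, 3}" and A_line: "card A = 2" "A \<subseteq> joint_line S i" by blast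
  define x :: "'a dowling_point" where "x = Joint (next_index (next_index i))"
  have x: "x \<in> dowling_ground S" "x \<notin> joint_line S i"
    using i by (auto simp: x_def)
  have "\<not> insert x A \<subseteq> l" if "l \<in> dowling_lines S R" for l
    using dowling_line_through_joint_pair[OF i A_line that, of "next_index (next_index i)"] x(2)
    by (auto simp: x_def)
  then show ?thesis
    using x A_line(2) by (intro that[of x] dowling_indep_insert[OF A card]) auto
next
  case False
  have "card (Joint ` {1, 2, 3 :: nat} :: 'a dowling_point set) = 3"
    by (simp add: card_image inj_on_def)
  then have "\<not> Joint ` {1, 2, 3} \<subseteq> A"
    using card A card_mono[of A "Joint ` {1, 2, 3}"] by (auto simp: dowling_indep_def)
  then obtain j where j: "j \<in> {1, 2, 3}" "Joint j \<notin> A" by blast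
  have "\<not> insert (Joint j) A \<subseteq> l" if "card A = 2" "l \<in> dowling_lines S R" for l
    using that(2) by (cases rule: dowling_lines_cases) (use that(1) False in auto)
  then show ?thesis
    using j by (intro that[of "Joint j"] dowling_indep_insert[OF A card]) auto
qed

fun point_index :: "'s dowling_point \<Rightarrow> nat" where
  "point_index (Joint i) = i"
| "point_index (Elt s i) = i"

lemma joint_line_point_index:
  assumes "x \<in> dowling_ground S"
  shows "point_index x \<in> {1, 2, 3}" "x \<in> joint_line S (point_index x)"
  using assms by (cases x; simp)+

context
  fixes S :: "'s set" and A :: "'s dowling_point set"
  assumes ground: "A \<subseteq> dowling_ground S" and card_A: "card A = 3"
    and no_joint_pair: "\<And>i x y. i \<in> {1, 2, 3} \<Longrightarrow> x \<in> A \<inter> joint_line S i \<Longrightarrow>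
      y \<in> A \<inter> joint_line S i \<Longrightarrow> x = y"
begin

lemma point_index_image_of_no_joint_pair: "point_index ` A = {1, 2, 3}"
proof -
  note index = joint_line_point_index[OF subsetD[OF ground]]
  have "inj_on point_index A"
    using index no_joint_pair by (intro inj_onI) (metis IntI)
  then show ?thesis
    using card_A index(1) by (intro card_subset_eq) (auto simp: card_image)
qed

lemma ex_Elt_of_no_joint_pair:
  assumes i: "i \<in> {1, 2, 3}"
  shows "\<exists>s\<in>S. Elt s i \<in> A"
proof -
  have "\<exists>x\<in>A. point_index x = j" if "j \<in> {1, 2, 3}" for j
    using that unfolding point_index_image_of_no_joint_pair[symmetric] by auto
  then obtain x y where x: "x \<in> A" "point_index x = i"
    and y: "y \<in> A" "point_index y = next_index (next_index i)"
    using i next_index_mem[of "next_index i"] by metis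
  show ?thesis
  proof (cases x)
    case (Elt s j)
    then show ?thesis using x subsetD[OF ground x(1)] by auto
  next
    case (Joint j)
    then have "x \<in> joint_line S (next_index (next_index i))"
      using x(2) next_index_cycle[OF i] by simp
    moreover have "y \<in> joint_line S (next_index (next_index i))"
      using joint_line_point_index(2)[of y S] y ground by auto
    ultimately have "x = y"
      using no_joint_pair[OF next_index_mem] x(1) y(1) by blast
    then show ?thesis using x(2) y(2) i by auto
  qed
qed

lemma relator_line_of_no_joint_pair:
  obtains s s' s'' where "s \<in> S" "s' \<in> S" "s'' \<in> S" "A = relator_line s s' s'' 1"
proof -
  obtain s s' s'' where s: "s \<in> S" "s' \<in> S" "s'' \<in> S" "Elt s 1 \<in> A" "Elt s' 2 \<in> A" "Elt s'' 3 \<in> A"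
    using ex_Elt_of_no_joint_pair[of 1] ex_Elt_of_no_joint_pair[of 2] ex_Elt_of_no_joint_pair[of 3]
    by auto
  have "finite A" using card_A card.infinite by fastforce
  then have "relator_line s s' s'' 1 = A"
    using s card_A by (intro card_subset_eq) (auto simp: relator_line_def)
  then show ?thesis using s that by blast
qed

end

section \<open>Approximate actions\<close>

lemma (in symmetric_triangular) relator_product_eq_one:
  assumes "[s'', s', s] \<in> R"
  shows "tri_gen S R e s'' \<otimes>\<^bsub>tri_group S R e\<^esub> tri_gen S R e s' \<otimes>\<^bsub>tri_group S R e\<^esub> tri_gen S R e s
    = \<one>\<^bsub>tri_group S R e\<^esub>"
proof -
  let ?R = "tri_relators R e" and ?w = "[(s'', True), (s', True), (s, True)]"
  have S: "s \<in> S" "s' \<in> S" "s'' \<in> S"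
    using relator_words[OF assms] by auto
  have "?w \<in> ?R"
    using assms by (force simp: tri_relators_def positive_word_def)
  then have "word_equiv S ?R ([] @ ?w @ []) ([] @ [])"
    using S by (intro word_equiv.relator) auto
  then have "word_rel S ?R `` {?w} = word_rel S ?R `` {[]}"
    by (intro equiv_class_eq[OF equiv_word_rel]) (simp add: word_rel_def)
  then show ?thesis
    using S
    by (simp add: tri_group_def tri_gen_def presented_gen_def presented_group_mult)
      (simp add: presented_group_def)
qed

locale approximate_action =
  symmetric_triangular S R e sinv + finite_dimensional_vector_space scale Basis
  for S :: "'s set" and R :: "'s list set" and e :: 's and sinv :: "'s \<Rightarrow> 's"
    and scale :: "'f::field \<Rightarrow> 'w::ab_group_add \<Rightarrow> 'w" and Basis :: "'w set" +
  fixes \<rho> :: "'s \<Rightarrow> 'w \<Rightarrow> 'w" and \<epsilon> :: real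
  assumes rho_general_linear: "s \<in> S \<Longrightarrow> \<rho> s \<in> general_linear scale"
    and d_rk_distinct: "s \<in> S \<Longrightarrow> s' \<in> S \<Longrightarrow> s \<noteq> s' \<Longrightarrow> d_rk scale (\<rho> s) (\<rho> s') \<ge> 1 - \<epsilon>"
    and d_rk_nonrelator: "s \<in> S \<Longrightarrow> s' \<in> S \<Longrightarrow> s'' \<in> S \<Longrightarrow> [s'', s', s] \<notin> R \<Longrightarrow>
      d_rk scale (\<rho> s'' \<circ> \<rho> s' \<circ> \<rho> s) id \<ge> 1 - \<epsilon>"
    and d_rk_relator: "[s'', s', s] \<in> R \<Longrightarrow> d_rk scale (\<rho> s'' \<circ> \<rho> s' \<circ> \<rho> s) id \<le> \<epsilon>"
begin

lemma eps_nonneg: "\<epsilon> \<ge> 0"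
  using d_rk_relator[OF eee_relator] d_rk_nonneg by (rule order_trans[rotated])

lemma linear_rho: "s \<in> S \<Longrightarrow> Vector_Spaces.linear scale scale (\<rho> s)"
  using rho_general_linear by (simp add: general_linear_def)

lemma linear_rho_triple:
  assumes "s \<in> S" "s' \<in> S" "s'' \<in> S"
  shows "Vector_Spaces.linear scale scale (\<rho> s'' \<circ> \<rho> s' \<circ> \<rho> s)"
  using assms by (intro Vector_Spaces.linear_compose[where ?s2.0 = scale] linear_rho)

lemma rho_eq_0_iff:
  assumes "s \<in> S"
  shows "\<rho> s w = 0 \<longleftrightarrow> w = 0"
proof -
  interpret Vector_Spaces.linear scale scale "\<rho> s" by (rule linear_rho[OF assms])
  have "inj (\<rho> s)"
    using rho_general_linear[OF assms] by (auto simp: general_linear_def bij_is_inj)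
  from inj_eq[OF this, of w 0] show ?thesis by (simp add: zero)
qed

lemma dim_coincidence_le:
  assumes "s \<in> S" "s' \<in> S" "s \<noteq> s'"
  shows "real (dim {w. \<rho> s w = \<rho> s' w}) \<le> \<epsilon> * dimension"
  using d_rk_distinct[OF assms]
  by (simp add: dim_coincidence_eq_d_rk linear_rho assms mult_right_mono)

lemma dim_fixed_le:
  assumes s: "s \<in> S" "s' \<in> S" "s'' \<in> S" and "[s'', s', s] \<notin> R"
  shows "real (dim {w. \<rho> s'' (\<rho> s' (\<rho> s w)) = w}) \<le> \<epsilon> * dimension"
  using d_rk_nonrelator[OF assms] dim_coincidence_eq_d_rk[OF linear_rho_triple[OF s] linear_id]
  by (simp add: mult_right_mono)

lemma dim_moved_le:
  assumes "[s'', s', s] \<in> R"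
  shows "real (dim (range (\<lambda>w. \<rho> s'' (\<rho> s' (\<rho> s w)) - w))) \<le> \<epsilon> * dimension"
  using d_rk_relator[OF assms] rk_diff_eq_d_rk[of "\<rho> s'' \<circ> \<rho> s' \<circ> \<rho> s" id]
  by (simp add: rk_def mult_right_mono)

sublocale W2: finite_dimensional_vector_space_prod scale scale Basis Basis
  by unfold_locales

sublocale W_W2: finite_dimensional_vector_space_pair scale Basis W2.scale W2.Basis_pair
  by unfold_locales

sublocale W3: finite_dimensional_vector_space_prod scale W2.scale Basis W2.Basis_pair
  by unfold_locales

sublocale W2_W: finite_dimensional_vector_space_pair W2.scale W2.Basis_pair scale Basis
  by unfold_locales

sublocale W3_W: finite_dimensional_vector_space_pair W3.scale W3.Basis_pair scale Basis
  by unfold_locales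

sublocale W3_W2: finite_dimensional_vector_space_pair W3.scale W3.Basis_pair W2.scale W2.Basis_pair
  by unfold_locales

lemma card_W3_Basis: "card W3.Basis_pair = 3 * dimension"
  using W3.dimension_pair W2.dimension_pair by (simp add: W3.p.dimension_def)

definition coord :: "nat \<Rightarrow> 'w \<times> 'w \<times> 'w \<Rightarrow> 'w" where
  "coord i v = (if i = 1 then fst v else if i = 2 then fst (snd v) else snd (snd v))"

definition line_coords :: "nat \<Rightarrow> 'w \<times> 'w \<times> 'w \<Rightarrow> 'w \<times> 'w" where
  "line_coords i v = (coord i v, coord (next_index i) v)"

fun point_map :: "'s dowling_point \<Rightarrow> 'w \<times> 'w \<times> 'w \<Rightarrow> 'w" where
  "point_map (Joint i) v = coord i v"
| "point_map (Elt s i) v = coord (next_index i) v - \<rho> s (coord i v)"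

abbreviation point_kernel :: "'s dowling_point set \<Rightarrow> ('w \<times> 'w \<times> 'w) set" where
  "point_kernel \<equiv> common_kernel point_map"

lemma linear_coord: "Vector_Spaces.linear W3.scale scale (coord i)"
  unfolding Vector_Spaces.linear_iff
  using W3.p.vector_space_axioms vector_space_axioms
  by (auto simp: coord_def W3.scale_def W2.scale_def)

lemma linear_line_coords: "Vector_Spaces.linear W3.scale W2.scale (line_coords i)"
  using linear_coord W2.p.vector_space_axioms
  by (simp add: Vector_Spaces.linear_iff line_coords_def W2.scale_def)

lemma linear_point_map:
  assumes "x \<in> dowling_ground S"
  shows "Vector_Spaces.linear W3.scale scale (point_map x)"
proof (cases x)
  case (Joint i)
  then have "point_map x = coord i" by (simp add: fun_eq_iff)
  then show ?thesis by (simp add: linear_coord)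
next
  case (Elt s i)
  then have "Vector_Spaces.linear scale scale (\<rho> s)"
    using assms by (intro linear_rho) simp
  then have "Vector_Spaces.linear W3.scale scale (\<lambda>v. \<rho> s (coord i v))"
    using Vector_Spaces.linear_compose[OF linear_coord] by (simp add: comp_def)
  moreover have "point_map x = (\<lambda>v. coord (next_index i) v - \<rho> s (coord i v))"
    using Elt by (simp add: fun_eq_iff)
  ultimately show ?thesis
    using W3_W.linear_compose_sub[OF linear_coord] by simp
qed

lemma subspace_kernel: "A \<subseteq> dowling_ground S \<Longrightarrow> W3.p.subspace (point_kernel A)"
  by (intro subspace_common_kernel[where ?s2.0 = scale] linear_point_map
      W3.p.vector_space_axioms vector_space_axioms) auto

lemma surj_point_map:
  assumes "x \<in> dowling_ground S"
  shows "surj (point_map x)"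
proof (rule surjI)
  fix w :: 'w
  let ?i = "case x of Joint i \<Rightarrow> i | Elt s i \<Rightarrow> next_index i"
  let ?v = "(if ?i = 1 then w else 0, if ?i = 2 then w else 0, if ?i = 3 then w else 0)"
  show "point_map x ?v = w"
    using assms by (cases x) (auto simp: coord_def rho_eq_0_iff)
qed

lemma line_coords_eq_0_imp_eq_0:
  assumes i: "i \<in> {1, 2, 3}" and x: "x \<in> dowling_ground S" "x \<notin> joint_line S i"
    and v: "line_coords i v = 0" "point_map x v = 0"
  shows "v = 0"
proof -
  have "coord (next_index (next_index i)) v = 0"
    using assms by (cases x) (auto simp: line_coords_def zero_prod_def rho_eq_0_iff)
  then show ?thesis
    using i v(1) by (cases v) (auto simp: line_coords_def coord_def zero_prod_def)
qed

lemma point_map_factors_through_line_coords: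
  assumes "x \<in> joint_line S i"
  shows "\<exists>h. Vector_Spaces.linear W2.scale scale h \<and> (\<forall>v. point_map x v = h (line_coords i v))"
proof -
  consider (first) "x = Joint i" | (second) "x = Joint (next_index i)"
    | (element) s where "s \<in> S" "x = Elt s i"
    using assms by (auto simp: joint_line_def)
  then show ?thesis
  proof cases
    case first
    then show ?thesis by (intro exI[of _ fst]) (simp add: W2.linear_fst line_coords_def)
  next
    case second
    then show ?thesis by (intro exI[of _ snd]) (simp add: W2.linear_snd line_coords_def)
  next
    case (element s)
    have "Vector_Spaces.linear W2.scale scale (\<rho> s \<circ> fst)"
      using element(1) by (intro Vector_Spaces.linear_compose[OF W2.linear_fst] linear_rho)
    then have "Vector_Spaces.linear W2.scale scale (\<lambda>p. snd p - (\<rho> s \<circ> fst) p)"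
      by (intro W2_W.linear_compose_sub W2.linear_snd)
    then show ?thesis
      using element(2) by (intro exI[of _ "\<lambda>p. snd p - (\<rho> s \<circ> fst) p"]) (simp add: line_coords_def)
  qed
qed

lemma dim_line_coords_kernel_le:
  assumes yz: "y \<in> joint_line S i" "z \<in> joint_line S i" "y \<noteq> z"
  shows "real (W2.p.dim (line_coords i ` point_kernel {y, z})) \<le> \<epsilon> * dimension"
proof (cases "\<exists>s s'. s \<in> S \<and> s' \<in> S \<and> y = Elt s i \<and> z = Elt s' i")
  case True
  then obtain s s' where s: "s \<in> S" "s' \<in> S" "y = Elt s i" "z = Elt s' i" by blast
  define graph where "graph w = (w, \<rho> s w)" for w
  have "Vector_Spaces.linear scale W2.scale graph"
    using linear_rho[OF s(1)] W2.p.vector_space_axioms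
    by (simp add: Vector_Spaces.linear_iff graph_def W2.scale_def)
  then have "W2.p.dim (graph ` {w. \<rho> s w = \<rho> s' w}) \<le> dim {w. \<rho> s w = \<rho> s' w}"
    by (rule W_W2.dim_image_le)
  moreover have "line_coords i ` point_kernel {y, z} \<subseteq> graph ` {w. \<rho> s w = \<rho> s' w}"
    using s(3,4) by (auto simp: common_kernel_def line_coords_def graph_def)
  then have "W2.p.dim (line_coords i ` point_kernel {y, z})
      \<le> W2.p.dim (graph ` {w. \<rho> s w = \<rho> s' w})"
    by (rule W2.p.dim_subset)
  moreover have "real (dim {w. \<rho> s w = \<rho> s' w}) \<le> \<epsilon> * dimension"
    using s yz(3) by (intro dim_coincidence_le) auto
  ultimately show ?thesis by linarith
next
  case False
  have "line_coords i ` point_kernel {y, z} \<subseteq> {0}"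
    using False yz
    by (auto simp: common_kernel_def joint_line_def line_coords_def zero_prod_def rho_eq_0_iff)
  then have "W2.p.dim (line_coords i ` point_kernel {y, z}) = 0" by (simp only: W2.p.dim_eq_0)
  then show ?thesis using eps_nonneg by (simp del: W2.p.dim_eq_0)
qed

lemma dim_kernel_le_of_joint_pair:
  assumes i: "i \<in> {1, 2, 3}" and yz: "y \<in> joint_line S i" "z \<in> joint_line S i" "y \<noteq> z"
    and x: "x \<notin> joint_line S i" and A: "A \<subseteq> dowling_ground S" "{x, y, z} \<subseteq> A"
  shows "real (W3.p.dim (point_kernel A)) \<le> \<epsilon> * dimension"
proof -
  have "v = 0" if "v \<in> point_kernel A" "line_coords i v = 0" for v
    using that(1) A
    by (intro line_coords_eq_0_imp_eq_0[OF i _ x that(2)]) (auto simp: common_kernel_def)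
  then have "W3.p.dim (point_kernel A) = W2.p.dim (line_coords i ` point_kernel A)"
    by (intro W3_W2.dim_image_eq_of_trivial_kernel[symmetric]
        linear_line_coords subspace_kernel A(1))
  also have "\<dots> \<le> W2.p.dim (line_coords i ` point_kernel {y, z})"
    using A(2) by (intro W2.p.dim_subset image_mono) (auto simp: common_kernel_def)
  finally show ?thesis using dim_line_coords_kernel_le[OF yz] by linarith
qed

lemma kernel_relator_pair_iff:
  "v \<in> point_kernel {Elt s i, Elt s' (next_index i)} \<longleftrightarrow> coord (next_index i) v = \<rho> s (coord i v) \<and>
    coord (next_index (next_index i)) v = \<rho> s' (\<rho> s (coord i v))"
  by (auto simp: common_kernel_def)

lemma point_map_relator_point:
  assumes "i \<in> {1, 2, 3}" "v \<in> point_kernel {Elt s i, Elt s' (next_index i)}"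
  shows "point_map (Elt s'' (next_index (next_index i))) v
    = coord i v - \<rho> s'' (\<rho> s' (\<rho> s (coord i v)))"
  using assms(2) by (simp add: next_index_cycle[OF assms(1)] kernel_relator_pair_iff)

lemma dim_kernel_nonrelator_le:
  assumes i: "i \<in> {1, 2, 3}" and s: "s \<in> S" "s' \<in> S" "s'' \<in> S" and R: "[s'', s', s] \<notin> R"
  shows "real (W3.p.dim (point_kernel (relator_line s s' s'' i))) \<le> \<epsilon> * dimension"
proof -
  let ?A = "relator_line s s' s'' i"
  have pair: "v \<in> point_kernel {Elt s i, Elt s' (next_index i)}"
    and third: "point_map (Elt s'' (next_index (next_index i))) v = 0"
    if "v \<in> point_kernel ?A" for v
    using that by (auto simp: common_kernel_def relator_line_def)
  have "v = 0" if v: "v \<in> point_kernel ?A" "coord i v = 0" for v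
  proof (rule line_coords_eq_0_imp_eq_0[OF i])
    show "line_coords i v = 0"
      using pair[OF v(1)] v(2) s
      by (simp add: kernel_relator_pair_iff line_coords_def zero_prod_def rho_eq_0_iff)
    show "point_map (Elt s' (next_index i)) v = 0"
      using pair[OF v(1)] by (simp add: common_kernel_def)
  qed (use i s in auto)
  then have "W3.p.dim (point_kernel ?A) = dim (coord i ` point_kernel ?A)"
    using i s next_index_mem
    by (intro W3_W.dim_image_eq_of_trivial_kernel[symmetric] linear_coord subspace_kernel)
      (auto simp: relator_line_def simp del: insert_iff)
  also have "\<dots> \<le> dim {w. \<rho> s'' (\<rho> s' (\<rho> s w)) = w}"
    using third point_map_relator_point[OF i pair, of _ s''] by (intro dim_subset) auto
  finally show ?thesis using dim_fixed_le[OF s R] by linarith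
qed

lemma dim_kernel_basis_le:
  assumes A: "dowling_indep S R A" "card A = 3"
  shows "real (W3.p.dim (point_kernel A)) \<le> \<epsilon> * dimension"
proof -
  have ground: "A \<subseteq> dowling_ground S" and not_line: "\<And>l. l \<in> dowling_lines S R \<Longrightarrow> \<not> A \<subseteq> l"
    using A by (auto simp: dowling_indep_def)
  show ?thesis
  proof (cases "\<exists>i\<in>{1, 2, 3}. \<exists>y z. y \<in> A \<inter> joint_line S i \<and> z \<in> A \<inter> joint_line S i \<and> y \<noteq> z")
    case True
    then obtain i y z where i: "i \<in> {1, 2, 3}"
      and yz: "y \<in> A \<inter> joint_line S i" "z \<in> A \<inter> joint_line S i" "y \<noteq> z" by blast
    have "joint_line S i \<in> dowling_lines S R"
      using i unfolding dowling_lines_eq by blast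
    then obtain x where "x \<in> A" "x \<notin> joint_line S i" using not_line by blast
    then show ?thesis
      using yz by (intro dim_kernel_le_of_joint_pair[OF i _ _ yz(3) _ ground]) auto
  next
    case False
    obtain s s' s'' where s: "s \<in> S" "s' \<in> S" "s'' \<in> S" "A = relator_line s s' s'' 1"
      using relator_line_of_no_joint_pair[OF ground A(2)] False by metis
    have "[s'', s', s] \<notin> R"
      using not_line[of A] s(4) unfolding dowling_lines_eq by blast
    then show ?thesis unfolding s(4) by (intro dim_kernel_nonrelator_le s) simp_all
  qed
qed

lemma dim_kernel_independent_le:
  assumes "dowling_indep S R A"
  shows "real (W3.p.dim (point_kernel A)) \<le> (3 - real (card A)) * dimension + \<epsilon> * dimension"
  using assms
proof (induction "3 - card A" arbitrary: A)
  case 0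
  then have "card A = 3" by (auto simp: dowling_indep_def)
  then show ?case using dim_kernel_basis_le[OF "0.prems"] by simp
next
  case (Suc n)
  have ground: "A \<subseteq> dowling_ground S" and fin: "finite A"
    using Suc.prems by (auto simp: dowling_indep_def)
  have "card A < 3" using Suc.hyps(2) by linarith
  then obtain x where x: "x \<in> dowling_ground S" "x \<notin> A" "dowling_indep S R (insert x A)"
    by (rule dowling_indep_extend[OF Suc.prems])
  have "dim (point_map x ` point_kernel A) + W3.p.dim (point_kernel (insert x A))
      = W3.p.dim (point_kernel A)"
    using W3_W.rank_nullity[OF linear_point_map[OF x(1)] subspace_kernel[OF ground]]
    by (simp add: common_kernel_insert)
  moreover have "dim (point_map x ` point_kernel A) \<le> dimension"
    by (rule dim_subset_UNIV)
  moreover have "real (W3.p.dim (point_kernel (insert x A)))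
      \<le> (3 - real (card (insert x A))) * dimension + \<epsilon> * dimension"
    using x fin Suc.hyps(2) by (intro Suc.hyps(1)) auto
  ultimately show ?case
    using x(2) fin by (simp add: algebra_simps)
qed

lemma dim_image_joint_line_le:
  assumes C: "card C = 3" "C \<subseteq> joint_line S i" "x \<in> C"
  shows "real (dim (point_map x ` point_kernel (C - {x}))) \<le> \<epsilon> * dimension"
proof -
  have "card (C - {x}) = 2" using C by simp
  then obtain y z where yz: "C - {x} = {y, z}" "y \<noteq> z" by (auto simp: card_2_iff)
  obtain h where h: "Vector_Spaces.linear W2.scale scale h"
      "\<And>v. point_map x v = h (line_coords i v)"
    using point_map_factors_through_line_coords C(2,3) by blast
  have "dim (point_map x ` point_kernel {y, z}) = dim (h ` line_coords i ` point_kernel {y, z})"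
    by (simp add: image_image h(2))
  also have "\<dots> \<le> W2.p.dim (line_coords i ` point_kernel {y, z})"
    by (rule W2_W.dim_image_le[OF h(1)])
  also have "real \<dots> \<le> \<epsilon> * dimension"
    using C(2) yz by (intro dim_line_coords_kernel_le) auto
  finally show ?thesis by (simp add: yz(1))
qed

lemma dim_image_relator_point_le:
  assumes i: "i \<in> {1, 2, 3}" and R: "[s'', s', s] \<in> R"
  shows "real (dim (point_map (Elt s'' (next_index (next_index i))) `
    point_kernel {Elt s i, Elt s' (next_index i)})) \<le> \<epsilon> * dimension"
proof -
  interpret triple: Vector_Spaces.linear scale scale "\<rho> s'' \<circ> \<rho> s' \<circ> \<rho> s"
    using relator_words[OF R] by (intro linear_rho_triple) auto
  let ?f = "\<lambda>w. \<rho> s'' (\<rho> s' (\<rho> s w)) - w"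
  have neg: "w - \<rho> s'' (\<rho> s' (\<rho> s w)) = ?f (- w)" for w
    using triple.neg[of w] by simp
  have "point_map (Elt s'' (next_index (next_index i))) `
      point_kernel {Elt s i, Elt s' (next_index i)} \<subseteq> range ?f"
  proof (rule image_subsetI)
    fix v assume v: "v \<in> point_kernel {Elt s i, Elt s' (next_index i)}"
    show "point_map (Elt s'' (next_index (next_index i))) v \<in> range ?f"
      unfolding point_map_relator_point[OF i v] neg by blast
  qed
  from dim_subset[OF this] show ?thesis using dim_moved_le[OF R] by linarith
qed

lemma dim_image_relator_line_le:
  assumes i: "i \<in> {1, 2, 3}" and R: "[s'', s', s] \<in> R" and x: "x \<in> relator_line s s' s'' i"
  shows "real (dim (point_map x ` point_kernel (relator_line s s' s'' i - {x}))) \<le> \<epsilon> * dimension"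
proof -
  have last: "real (dim (point_map x ` point_kernel (relator_line t t' t'' j - {x})))
      \<le> \<epsilon> * dimension"
    if "j \<in> {1, 2, 3}" "[t'', t', t] \<in> R" "x = Elt t'' (next_index (next_index j))" for t t' t'' j
  proof -
    have "relator_line t t' t'' j - {x} = {Elt t j, Elt t' (next_index j)}"
      using that(1,3) by (auto simp: relator_line_def)
    then show ?thesis using dim_image_relator_point_le[OF that(1,2)] that(3) by simp
  qed
  consider (third) "x = Elt s'' (next_index (next_index i))" | (first) "x = Elt s i"
    | (second) "x = Elt s' (next_index i)"
    using x by (auto simp: relator_line_def)
  then show ?thesis
  proof cases
    case third
    then show ?thesis by (rule last[OF i R])
  next
    case first
    then have "x = Elt s (next_index (next_index (next_index i)))"
      by (simp only: next_index_cycle[OF i])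
    then show ?thesis
      unfolding relator_line_rotate[OF i, of s' s'' s, symmetric]
      by (rule last[OF next_index_mem relator_rotate2[OF R]])
  next
    case second
    then have "x = Elt s' (next_index (next_index (next_index (next_index i))))"
      by (simp only: next_index_cycle[OF i])
    then show ?thesis
      unfolding relator_line_rotate[OF i, of s' s'' s, symmetric]
        relator_line_rotate[OF next_index_mem, of s'' s s' i, symmetric]
      by (rule last[OF next_index_mem relator_rotate1[OF R]])
  qed
qed

lemma dim_image_circuit_le:
  assumes C: "circuit (dowling_ground S) (dowling_indep S R) C" and x: "x \<in> C"
  shows "real (dim (point_map x ` point_kernel (C - {x}))) \<le> \<epsilon> * dimension"
proof -
  have ground: "C \<subseteq> dowling_ground S" and dep: "\<not> dowling_indep S R C"
    and indep: "dowling_indep S R (C - {x})"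
    using C x unfolding circuit_def by blast+
  then have fin: "finite C" by (simp add: dowling_indep_def)
  have "2 < card C" using dep ground fin by (auto simp: dowling_indep_def)
  moreover have "card (C - {x}) \<le> 3" using indep by (auto simp: dowling_indep_def)
  ultimately consider (line) "card C = 3" | (basis) "card (C - {x}) = 3"
    using card_Suc_Diff1[OF fin x] by linarith
  then show ?thesis
  proof cases
    case line
    then obtain l where l: "l \<in> dowling_lines S R" "C \<subseteq> l"
      using dep ground fin by (auto simp: dowling_indep_def)
    from l(1) show ?thesis
    proof (cases rule: dowling_lines_cases)
      case (joint i)
      then show ?thesis using dim_image_joint_line_le line l(2) x by blast
    next
      case (relator s s' s'' i)
      have "finite l" "card l \<le> card C"
        unfolding line relator(3) relator_line_def by (simp_all add: card_insert_if)
      then have "C = l" using l(2) by (metis card_seteq)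
      then show ?thesis using dim_image_relator_line_le relator x by blast
    qed
  next
    case basis
    have "dim (point_map x ` point_kernel (C - {x})) \<le> W3.p.dim (point_kernel (C - {x}))"
      using x ground by (intro W3_W.dim_image_le linear_point_map) auto
    then show ?thesis using dim_kernel_basis_le[OF indep basis] by linarith
  qed
qed

theorem has_approx_representation_dowling:
  assumes "Basis \<noteq> {}"
  shows "has_approx_representation TYPE('f) (dowling_ground S) (dowling_indep S R) \<epsilon>"
proof -
  have "approx_representation W3.scale scale (dowling_ground S) (dowling_indep S R) \<epsilon> (card Basis)
      UNIV (\<lambda>_. UNIV) point_map"
  proof (rule approx_representation_of_common_kernels)
    show "real (W3.p.dim (point_kernel A))
        \<le> real (card W3.Basis_pair) - real (card Basis) * (real (card A) - \<epsilon>)"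
      if "dowling_indep S R A" for A
      using dim_kernel_independent_le[OF that] unfolding card_W3_Basis
      by (simp add: dimension_def algebra_simps)
    show "real (dim (point_map x ` point_kernel (C - {x}))) \<le> real (card Basis) * \<epsilon>"
      if "circuit (dowling_ground S) (dowling_indep S R) C" "x \<in> C" for C x
      using dim_image_circuit_le[OF that] by (simp add: dimension_def mult.commute)
  qed (fact assms linear_point_map surj_point_map W3.p.finite_dimensional_vector_space_axioms
      finite_dimensional_vector_space_axioms)+
  then show ?thesis
    by (rule has_approx_representationI) unfold_locales
qed

end

text \<open>If \<open>dim W = 0\<close>, then \<^const>\<open>d_rk\<close> is identically \<open>0 / 0 = 0\<close>, and by (a) one of these
  cases occurs.\<close>

lemma (in symmetric_triangular) has_approx_representation_dowling_trivial:
  assumes "0 \<le> \<epsilon>" and "S = {e} \<or> 1 \<le> \<epsilon>"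
  shows "has_approx_representation TYPE('f::field) (dowling_ground S) (dowling_indep S R) \<epsilon>"
proof -
  interpret field: finite_dimensional_vector_space "(*) :: 'f \<Rightarrow> 'f \<Rightarrow> 'f" "{1}"
    by (rule finite_dimensional_vector_space_field)
  interpret approximate_action S R e sinv "(*) :: 'f \<Rightarrow> 'f \<Rightarrow> 'f" "{1}" "\<lambda>_. id" \<epsilon>
  proof unfold_locales
    show "id \<in> general_linear ((*) :: 'f \<Rightarrow> 'f \<Rightarrow> 'f)"
      by (simp add: general_linear_def field.linear_id)
  qed (use assms eee_relator in \<open>auto simp: field.d_rk_self\<close>)
  show ?thesis by (rule has_approx_representation_dowling) simp
qed

theorem theorem9p8:
  fixes S :: "'s set" and R :: "'s list set" and e :: 's and sinv :: "'s \<Rightarrow> 's"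
    and scale :: "'f::field \<Rightarrow> 'w::ab_group_add \<Rightarrow> 'w" and Basis :: "'w set"
    and \<rho> :: "'s \<Rightarrow> 'w \<Rightarrow> 'w" and \<epsilon> :: real
    and G :: "('s \<times> bool) list set monoid" and g :: "'s \<Rightarrow> ('s \<times> bool) list set"
  defines "G \<equiv> tri_group S R e" and "g \<equiv> tri_gen S R e"
  assumes pres: "symmetric_triangular S R e sinv"
    and eps: "\<epsilon> \<ge> 0"
    and W: "finite_dimensional_vector_space scale Basis"
    and rho: "\<And>s. s \<in> S \<Longrightarrow> \<rho> s \<in> general_linear scale"
    and a: "\<And>s s'. s \<in> S \<Longrightarrow> s' \<in> S \<Longrightarrow> s \<noteq> s' \<Longrightarrow> d_rk scale (\<rho> s) (\<rho> s') \<ge> 1 - \<epsilon> / 18"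
    and b: "\<And>s s' s''. s \<in> S \<Longrightarrow> s' \<in> S \<Longrightarrow> s'' \<in> S \<Longrightarrow>
              g s'' \<otimes>\<^bsub>G\<^esub> g s' \<otimes>\<^bsub>G\<^esub> g s \<noteq> \<one>\<^bsub>G\<^esub> \<Longrightarrow>
              d_rk scale (\<rho> s'' \<circ> \<rho> s' \<circ> \<rho> s) id \<ge> 1 - \<epsilon> / 18"
    and c: "\<And>s s' s''. s \<in> S \<Longrightarrow> s' \<in> S \<Longrightarrow> s'' \<in> S \<Longrightarrow>
              g s'' \<otimes>\<^bsub>G\<^esub> g s' \<otimes>\<^bsub>G\<^esub> g s = \<one>\<^bsub>G\<^esub> \<Longrightarrow>
              d_rk scale (\<rho> s'' \<circ> \<rho> s' \<circ> \<rho> s) id \<le> \<epsilon> / 18"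
    and c_e: "d_rk scale (\<rho> e) id \<le> \<epsilon> / 18"
    and d: "\<And>s s' s''. s \<in> S \<Longrightarrow> s' \<in> S \<Longrightarrow> s'' \<in> S \<Longrightarrow>
              g s'' \<otimes>\<^bsub>G\<^esub> g s' \<otimes>\<^bsub>G\<^esub> g s = \<one>\<^bsub>G\<^esub> \<Longrightarrow> [s'', s', s] \<in> R"
  shows "has_approx_representation TYPE('f) (dowling_ground S) (dowling_indep S R) \<epsilon>"
proof -
  interpret symmetric_triangular S R e sinv by (rule pres)
  interpret W: finite_dimensional_vector_space scale Basis by (rule W)
  have "has_approx_representation TYPE('f) (dowling_ground S) (dowling_indep S R) (\<epsilon> / 18)"
  proof (cases "Basis = {}")
    case True
    then have "S = {e} \<or> 1 \<le> \<epsilon> / 18"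
      using a[OF _ e_in] e_in by (force simp: d_rk_def)
    then show ?thesis using eps by (intro has_approx_representation_dowling_trivial) simp_all
  next
    case False
    interpret approximate_action S R e sinv scale Basis \<rho> "\<epsilon> / 18"
    proof unfold_locales
      fix s s' s''
      show "d_rk scale (\<rho> s'' \<circ> \<rho> s' \<circ> \<rho> s) id \<ge> 1 - \<epsilon> / 18"
        if "s \<in> S" "s' \<in> S" "s'' \<in> S" "[s'', s', s] \<notin> R" using b d that by blast
      show "d_rk scale (\<rho> s'' \<circ> \<rho> s' \<circ> \<rho> s) id \<le> \<epsilon> / 18" if "[s'', s', s] \<in> R"
        using that relator_words[OF that] relator_product_eq_one[OF that]
        by (intro c) (simp_all add: G_def g_def)
    qed (fact rho a)+
    show ?thesis by (rule has_approx_representation_dowling[OF False])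
  qed
  then show ?thesis
    by (rule has_approx_representation_mono) (use eps in simp)
qed

end
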